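(* Let $T=(T,\eta,\mu)$ be a monad on a category $\mathcal{E}$, let $(L,\alpha)$ be a left adjoint right $T$-module with values in a category $\mathcal{C}$, and choose an adjunction $L\colon\mathcal{E}\rightleftarrows\mathcal{C}\colon R$ with $L\dashv R$. Assume that for every $T$-algebra $(X,a)$ the coequalizer in $\mathcal{C}$ of the pair $$La,\ \alpha_X\colon LTX\rightrightarrows LX$$ exists. Then the comparison functor $K_\alpha\colon\mathcal{C}\to\mathrm{Alg}(T)$ and the realization functor $\Phi_\alpha\colon\mathrm{Alg}(T)\to\mathcal{C}$ form an adjunction $$\Phi_\alpha\colon\mathrm{Alg}(T)\rightleftarrows\mathcal{C}\colon K_\alpha,$$ with $\Phi_\alpha\dashv K_\alpha$.
   Context: $\mathrm{Alg}(T)$ is the Eilenberg--Moore category of $T$. A right $T$-module with values in $\mathcal{C}$ is a pair $(L,\alpha)$ with $L\colon\mathcal{E}\to\mathcal{C}$ a functor and $\alpha\colon LT\Rightarrow L$ a natural transformation such that $\alpha\circ L\eta=\mathrm{Id}_L$ and $\alpha\circ L\mu=\alpha\circ\alpha_T$. It is a left adjoint right $T$-module if $L$ is a left adjoint. Comparison functor: let $\iota,\varepsilon$ be the unit and counit of $L\dashv R$, and let $\rho\colon TR\Rightarrow R$ be the mate of $\alpha$, $\rho_C=R(\varepsilon_C)\circ R(\alpha_{RC})\circ\iota_{TRC}$, which is a left $T$-module structure on $R$ (i.e. $\rho\circ\eta_R=\mathrm{Id}_R$, $\rho\circ\mu_R=\rho\circ T\rho$). Then $K_\alpha(C)=(RC,\rho_C)$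 and $K_\alpha(u)=R(u)$. Realization functor: $\Phi_\alpha(X,a)$ is the coequalizer $q_{(X,a)}\colon LX\to\Phi_\alpha(X,a)$ of $La,\alpha_X\colon LTX\rightrightarrows LX$; for a $T$-algebra morphism $f\colon(X,a)\to(Y,b)$, $\Phi_\alpha(f)$ is the unique morphism with $\Phi_\alpha(f)q_{(X,a)}=q_{(Y,b)}Lf$. *)

theory Defs
  imports Main
begin

text \<open>
  Categories are given by carrier sets of objects and morphisms.  All structure maps are total HOL
  functions whose values off the carriers (in particular on non-composable pairs) are unconstrained.
\<close>

record ('o, 'm) cat_data =
  Ob :: "'o set"
  Mor :: "'m set"
  Dom :: "'m \<Rightarrow> 'o"
  Cod :: "'m \<Rightarrow> 'o"
  ide :: "'o \<Rightarrow> 'm"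
  cmp :: "'m \<Rightarrow> 'm \<Rightarrow> 'm" (infixl "\<cdot>\<index>" 70)

definition hom :: "('o, 'm) cat_data \<Rightarrow> 'o \<Rightarrow> 'o \<Rightarrow> 'm set"
  where "hom C X Y = {f \<in> Mor C. Dom C f = X \<and> Cod C f = Y}"

locale category =
  fixes C :: "('o, 'm) cat_data"
  assumes Dom_Ob: "f \<in> Mor C \<Longrightarrow> Dom C f \<in> Ob C"
    and Cod_Ob: "f \<in> Mor C \<Longrightarrow> Cod C f \<in> Ob C"
    and ide_hom: "X \<in> Ob C \<Longrightarrow> ide C X \<in> hom C X X"
    and cmp_hom: "\<lbrakk>f \<in> hom C X Y; g \<in> hom C Y Z\<rbrakk> \<Longrightarrow> g \<cdot>\<^bsub>C\<^esub> f \<in> hom C X Z"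
    and cmp_ide_left: "f \<in> hom C X Y \<Longrightarrow> ide C Y \<cdot>\<^bsub>C\<^esub> f = f"
    and cmp_ide_right: "f \<in> hom C X Y \<Longrightarrow> f \<cdot>\<^bsub>C\<^esub> ide C X = f"
    and cmp_assoc: "\<lbrakk>f \<in> hom C W X; g \<in> hom C X Y; h \<in> hom C Y Z\<rbrakk>
      \<Longrightarrow> (h \<cdot>\<^bsub>C\<^esub> g) \<cdot>\<^bsub>C\<^esub> f = h \<cdot>\<^bsub>C\<^esub> (g \<cdot>\<^bsub>C\<^esub> f)"

record ('o, 'm, 'p, 'n) functor_data =
  fob :: "'o \<Rightarrow> 'p"
  farr :: "'m \<Rightarrow> 'n"

locale cat_functor = dom: category A + cod: category B
  for A :: "('o, 'm) cat_data" and B :: "('p, 'n) cat_data" +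
  fixes F :: "('o, 'm, 'p, 'n) functor_data"
  assumes fob_Ob: "X \<in> Ob A \<Longrightarrow> fob F X \<in> Ob B"
    and farr_hom: "f \<in> hom A X Y \<Longrightarrow> farr F f \<in> hom B (fob F X) (fob F Y)"
    and farr_ide: "X \<in> Ob A \<Longrightarrow> farr F (ide A X) = ide B (fob F X)"
    and farr_cmp: "\<lbrakk>f \<in> hom A X Y; g \<in> hom A Y Z\<rbrakk>
      \<Longrightarrow> farr F (g \<cdot>\<^bsub>A\<^esub> f) = farr F g \<cdot>\<^bsub>B\<^esub> farr F f"

definition id_functor :: "('o, 'm, 'o, 'm) functor_data"
  where "id_functor = \<lparr>fob = (\<lambda>X. X), farr = (\<lambda>f. f)\<rparr>"

definition cmp_functor ::
    "('p, 'n, 'q, 'k) functor_data \<Rightarrow> ('o, 'm, 'p, 'n) functor_data \<Rightarrow> ('o, 'm, 'q, 'k) functor_data"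
    (infixl "\<circ>\<^sub>F" 55)
  where "G \<circ>\<^sub>F F = \<lparr>fob = (\<lambda>X. fob G (fob F X)), farr = (\<lambda>f. farr G (farr F f))\<rparr>"

locale nat_trans = src: cat_functor A B F + tgt: cat_functor A B G
  for A :: "('o, 'm) cat_data" and B :: "('p, 'n) cat_data"
    and F :: "('o, 'm, 'p, 'n) functor_data" and G :: "('o, 'm, 'p, 'n) functor_data" +
  fixes \<tau> :: "'o \<Rightarrow> 'n"
  assumes component_hom: "X \<in> Ob A \<Longrightarrow> \<tau> X \<in> hom B (fob F X) (fob G X)"
    and naturality: "f \<in> hom A X Y \<Longrightarrow> \<tau> Y \<cdot>\<^bsub>B\<^esub> farr F f = farr G f \<cdot>\<^bsub>B\<^esub> \<tau> X"

locale adjunction =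
  unit: nat_trans A A id_functor "G \<circ>\<^sub>F F" \<iota> + counit: nat_trans B B "F \<circ>\<^sub>F G" id_functor \<epsilon> +
  left: cat_functor A B F + right: cat_functor B A G
  for A :: "('o, 'm) cat_data" and B :: "('p, 'n) cat_data"
    and F :: "('o, 'm, 'p, 'n) functor_data" and G :: "('p, 'n, 'o, 'm) functor_data"
    and \<iota> :: "'o \<Rightarrow> 'm" and \<epsilon> :: "'p \<Rightarrow> 'n" +
  assumes triangle_left: "X \<in> Ob A \<Longrightarrow> \<epsilon> (fob F X) \<cdot>\<^bsub>B\<^esub> farr F (\<iota> X) = ide B (fob F X)"
    and triangle_right: "Y \<in> Ob B \<Longrightarrow> farr G (\<epsilon> Y) \<cdot>\<^bsub>A\<^esub> \<iota> (fob G Y) = ide A (fob G Y)"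

definition adjoint_functors ::
    "('o, 'm) cat_data \<Rightarrow> ('p, 'n) cat_data \<Rightarrow> ('o, 'm, 'p, 'n) functor_data
      \<Rightarrow> ('p, 'n, 'o, 'm) functor_data \<Rightarrow> bool"
  where "adjoint_functors A B F G \<longleftrightarrow> (\<exists>\<iota> \<epsilon>. adjunction A B F G \<iota> \<epsilon>)"

definition is_coequalizer :: "('o, 'm) cat_data \<Rightarrow> 'm \<Rightarrow> 'm \<Rightarrow> 'm \<Rightarrow> bool"
  where "is_coequalizer C f g q \<longleftrightarrow>
    f \<in> Mor C \<and> g \<in> hom C (Dom C f) (Cod C f) \<and>
    q \<in> Mor C \<and> Dom C q = Cod C f \<and> q \<cdot>\<^bsub>C\<^esub> f = q \<cdot>\<^bsub>C\<^esub> g \<and>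
    (\<forall>h \<in> Mor C. Dom C h = Cod C f \<and> h \<cdot>\<^bsub>C\<^esub> f = h \<cdot>\<^bsub>C\<^esub> g
      \<longrightarrow> (\<exists>!k. k \<in> hom C (Cod C q) (Cod C h) \<and> k \<cdot>\<^bsub>C\<^esub> q = h))"

locale monad =
  endo: cat_functor E E T + unit: nat_trans E E id_functor T \<eta> + mult: nat_trans E E "T \<circ>\<^sub>F T" T \<mu>
  for E :: "('o, 'm) cat_data" and T :: "('o, 'm, 'o, 'm) functor_data"
    and \<eta> :: "'o \<Rightarrow> 'm" and \<mu> :: "'o \<Rightarrow> 'm" +
  assumes unit_left: "X \<in> Ob E \<Longrightarrow> \<mu> X \<cdot>\<^bsub>E\<^esub> \<eta> (fob T X) = ide E (fob T X)"
    and unit_right: "X \<in> Ob E \<Longrightarrow> \<mu> X \<cdot>\<^bsub>E\<^esub> farr T (\<eta> X) = ide E (fob T X)"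
    and mult_assoc: "X \<in> Ob E \<Longrightarrow> \<mu> X \<cdot>\<^bsub>E\<^esub> farr T (\<mu> X) = \<mu> X \<cdot>\<^bsub>E\<^esub> \<mu> (fob T X)"

definition algebras ::
    "('o, 'm) cat_data \<Rightarrow> ('o, 'm, 'o, 'm) functor_data \<Rightarrow> ('o \<Rightarrow> 'm) \<Rightarrow> ('o \<Rightarrow> 'm) \<Rightarrow> ('o \<times> 'm) set"
  where "algebras E T \<eta> \<mu> = {(X, a). X \<in> Ob E \<and> a \<in> hom E (fob T X) X \<and>
    a \<cdot>\<^bsub>E\<^esub> \<eta> X = ide E X \<and> a \<cdot>\<^bsub>E\<^esub> farr T a = a \<cdot>\<^bsub>E\<^esub> \<mu> X}"

text \<open>
  A morphism of the Eilenberg--Moore category is a triple of source algebra, underlying morphism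
  and target algebra: the same underlying morphism may be an algebra morphism for several choices of
  structure maps.
\<close>

definition Alg ::
    "('o, 'm) cat_data \<Rightarrow> ('o, 'm, 'o, 'm) functor_data \<Rightarrow> ('o \<Rightarrow> 'm) \<Rightarrow> ('o \<Rightarrow> 'm)
      \<Rightarrow> ('o \<times> 'm, ('o \<times> 'm) \<times> 'm \<times> ('o \<times> 'm)) cat_data"
  where "Alg E T \<eta> \<mu> =
    \<lparr>Ob = algebras E T \<eta> \<mu>,
     Mor = {((X, a), f, (Y, b)) | X a f Y b. (X, a) \<in> algebras E T \<eta> \<mu> \<and> (Y, b) \<in> algebras E T \<eta> \<mu> \<and>
       f \<in> hom E X Y \<and> f \<cdot>\<^bsub>E\<^esub> a = b \<cdot>\<^bsub>E\<^esub> farr T f},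
     Dom = (\<lambda>(x, f, y). x),
     Cod = (\<lambda>(x, f, y). y),
     ide = (\<lambda>(X, a). ((X, a), ide E X, (X, a))),
     cmp = (\<lambda>(y, g, z) (x, f, y'). (x, g \<cdot>\<^bsub>E\<^esub> f, z))\<rparr>"

locale right_module =
  monad E T \<eta> \<mu> + mod: cat_functor E C L + action: nat_trans E C "L \<circ>\<^sub>F T" L \<alpha>
  for E :: "('o, 'm) cat_data" and T :: "('o, 'm, 'o, 'm) functor_data"
    and \<eta> :: "'o \<Rightarrow> 'm" and \<mu> :: "'o \<Rightarrow> 'm" and C :: "('p, 'n) cat_data"
    and L :: "('o, 'm, 'p, 'n) functor_data" and \<alpha> :: "'o \<Rightarrow> 'n" +
  assumes action_unit: "X \<in> Ob E \<Longrightarrow> \<alpha> X \<cdot>\<^bsub>C\<^esub> farr L (\<eta> X) = ide C (fob L X)"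
    and action_mult: "X \<in> Ob E \<Longrightarrow> \<alpha> X \<cdot>\<^bsub>C\<^esub> farr L (\<mu> X) = \<alpha> X \<cdot>\<^bsub>C\<^esub> \<alpha> (fob T X)"

locale left_adjoint_right_module = right_module E T \<eta> \<mu> C L \<alpha>
  for E :: "('o, 'm) cat_data" and T :: "('o, 'm, 'o, 'm) functor_data"
    and \<eta> :: "'o \<Rightarrow> 'm" and \<mu> :: "'o \<Rightarrow> 'm" and C :: "('p, 'n) cat_data"
    and L :: "('o, 'm, 'p, 'n) functor_data" and \<alpha> :: "'o \<Rightarrow> 'n" +
  assumes left_adjoint: "\<exists>R. adjoint_functors E C L R"

definition mate ::
    "('o, 'm) cat_data \<Rightarrow> ('o, 'm, 'o, 'm) functor_data \<Rightarrow> ('p, 'n, 'o, 'm) functor_data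
      \<Rightarrow> ('o \<Rightarrow> 'm) \<Rightarrow> ('p \<Rightarrow> 'n) \<Rightarrow> ('o \<Rightarrow> 'n) \<Rightarrow> 'p \<Rightarrow> 'm"
  where "mate E T R \<iota> \<epsilon> \<alpha> c =
    farr R (\<epsilon> c) \<cdot>\<^bsub>E\<^esub> farr R (\<alpha> (fob R c)) \<cdot>\<^bsub>E\<^esub> \<iota> (fob T (fob R c))"

definition comparison_functor ::
    "('o, 'm) cat_data \<Rightarrow> ('o, 'm, 'o, 'm) functor_data \<Rightarrow> ('p, 'n) cat_data
      \<Rightarrow> ('p, 'n, 'o, 'm) functor_data \<Rightarrow> ('o \<Rightarrow> 'm) \<Rightarrow> ('p \<Rightarrow> 'n) \<Rightarrow> ('o \<Rightarrow> 'n)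
      \<Rightarrow> ('p, 'n, 'o \<times> 'm, ('o \<times> 'm) \<times> 'm \<times> ('o \<times> 'm)) functor_data"
  where "comparison_functor E T C R \<iota> \<epsilon> \<alpha> =
    (let K = (\<lambda>c. (fob R c, mate E T R \<iota> \<epsilon> \<alpha> c))
     in \<lparr>fob = K, farr = (\<lambda>u. (K (Dom C u), farr R u, K (Cod C u)))\<rparr>)"

text \<open>
  The realization functor depends on a choice of coequalizers, recorded by the family of
  coequalizer maps \<open>q\<close>; the coequalizer object is the codomain of \<open>q (X, a)\<close>.
\<close>

definition realization_choice ::
    "('o, 'm) cat_data \<Rightarrow> ('o, 'm, 'o, 'm) functor_data \<Rightarrow> ('o \<Rightarrow> 'm) \<Rightarrow> ('o \<Rightarrow> 'm)
      \<Rightarrow> ('p, 'n) cat_data \<Rightarrow> ('o, 'm, 'p, 'n) functor_data \<Rightarrow> ('o \<Rightarrow> 'n) \<Rightarrow> ('o \<times> 'm \<Rightarrow> 'n) \<Rightarrow> bool"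
  where "realization_choice E T \<eta> \<mu> C L \<alpha> q \<longleftrightarrow>
    (\<forall>(X, a) \<in> algebras E T \<eta> \<mu>. is_coequalizer C (farr L a) (\<alpha> X) (q (X, a)))"

definition realization_functor ::
    "('p, 'n) cat_data \<Rightarrow> ('o, 'm, 'p, 'n) functor_data \<Rightarrow> ('o \<times> 'm \<Rightarrow> 'n)
      \<Rightarrow> ('o \<times> 'm, ('o \<times> 'm) \<times> 'm \<times> ('o \<times> 'm), 'p, 'n) functor_data"
  where "realization_functor C L q =
    \<lparr>fob = (\<lambda>x. Cod C (q x)),
     farr = (\<lambda>(x, f, y). THE h. h \<in> hom C (Cod C (q x)) (Cod C (q y)) \<and>
       h \<cdot>\<^bsub>C\<^esub> q x = q y \<cdot>\<^bsub>C\<^esub> farr L f)\<rparr>"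

end

theory Submission
  imports Defs
begin

text \<open>
  Transposition along \<open>L \<stileturn> R\<close> identifies morphisms \<open>g: X \<rightarrow> R c\<close> with morphisms \<open>LX \<rightarrow> c\<close>.  The mate
  \<open>\<rho>\<close> is the transpose of \<open>\<epsilon> \<cdot> \<alpha>\<close>, so the two sides of the equation \<open>g \<cdot> a = \<rho> \<cdot> T g\<close>, which says
  that \<open>g\<close> is compatible with \<open>a: TX \<rightarrow> X\<close> and \<open>\<rho>\<close>, are the transposes of the two composites of the
  transpose of \<open>g\<close> with \<open>La\<close> and \<open>\<alpha>\<close> (lemma \<open>mate_compatible_iff_flat_coequalizes\<close>).  Hence algebra
  morphisms \<open>(X, a) \<rightarrow> K c\<close> are the same as morphisms \<open>LX \<rightarrow> c\<close> that coequalize \<open>La\<close> and \<open>\<alpha>\<close>, and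
  these are the same as morphisms \<open>\<Phi>(X, a) \<rightarrow> c\<close> by the universal property of the coequalizer.

  In other words, the transpose of the coequalizer map \<open>q: LX \<rightarrow> \<Phi>(X, a)\<close> is a universal arrow from
  \<open>(X, a)\<close> to \<open>K\<close>.  Universal arrows determine an adjunction
  (lemma \<open>adjoint_functors_if_universal_arrows\<close>), which also yields functoriality of \<open>\<Phi>\<close>: the
  morphism \<open>\<Phi>(f)\<close> is the one for which these arrows become natural.  The same criterion, applied to
  \<open>\<rho>\<close> itself and to \<open>R k\<close>, reduces the associativity of the algebra \<open>K c\<close> and the naturality of \<open>\<rho>\<close>
  to the module axiom for \<open>\<mu>\<close> and to the definition of \<open>\<rho>\<close>.
\<close>

section \<open>Adjunctions from universal arrows\<close>

lemma (in category) hom_Ob: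
  assumes "f \<in> hom C X Y"
  shows "X \<in> Ob C" "Y \<in> Ob C"
  using assms Dom_Ob Cod_Ob unfolding hom_def by auto

lemma cat_functor_id:
  assumes "category A"
  shows "cat_functor A A id_functor"
proof -
  interpret category A by fact
  show ?thesis by unfold_locales (auto simp: id_functor_def)
qed

lemma cat_functor_cmp:
  assumes "cat_functor A B F" and "cat_functor B D G"
  shows "cat_functor A D (G \<circ>\<^sub>F F)"
proof -
  interpret F: cat_functor A B F by fact
  interpret G: cat_functor B D G by fact
  show ?thesis
    by unfold_locales
      (auto simp: cmp_functor_def F.fob_Ob G.fob_Ob F.farr_hom G.farr_hom F.farr_ide G.farr_ide
        F.farr_cmp G.farr_cmp[OF F.farr_hom F.farr_hom])
qed

text \<open>
  Factorizations through a universal arrow are unique, so two morphisms out of \<open>F X\<close> agree once they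
  agree after applying \<open>G\<close> and precomposing with \<open>u X\<close>.  This cancellation proves functoriality of
  \<open>F\<close>, naturality of the counit and the triangle identity at \<open>F\<close>; the other triangle identity
  defines the counit.  The map \<open>F\<close> on morphisms is given rather than constructed, so that
  the lemma applies to a functor with a prescribed definition.
\<close>

lemma adjoint_functors_if_universal_arrows:
  assumes A: "category A" and G: "cat_functor B A G"
    and F_Ob: "\<And>X. X \<in> Ob A \<Longrightarrow> fob F X \<in> Ob B"
    and u_hom: "\<And>X. X \<in> Ob A \<Longrightarrow> u X \<in> hom A X (fob G (fob F X))"
    and univ: "\<And>X Y g. \<lbrakk>X \<in> Ob A; Y \<in> Ob B; g \<in> hom A X (fob G Y)\<rbrakk>
      \<Longrightarrow> \<exists>!k. k \<in> hom B (fob F X) Y \<and> farr G k \<cdot>\<^bsub>A\<^esub> u X = g"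
    and F_hom: "\<And>X X' f. f \<in> hom A X X' \<Longrightarrow> farr F f \<in> hom B (fob F X) (fob F X')"
    and F_u: "\<And>X X' f. f \<in> hom A X X' \<Longrightarrow> farr G (farr F f) \<cdot>\<^bsub>A\<^esub> u X = u X' \<cdot>\<^bsub>A\<^esub> f"
  shows "adjoint_functors A B F G"
proof -
  interpret A: category A by fact
  interpret G: cat_functor B A G by fact
  have cancel: "k = k'"
    if "X \<in> Ob A" "k \<in> hom B (fob F X) Y" "k' \<in> hom B (fob F X) Y"
      "farr G k \<cdot>\<^bsub>A\<^esub> u X = farr G k' \<cdot>\<^bsub>A\<^esub> u X" for X Y k k'
    using univ[OF that(1) G.dom.hom_Ob(2)[OF that(2)]
        A.cmp_hom[OF u_hom[OF that(1)] G.farr_hom[OF that(3)]]] that by blast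
  have G_cmp: "farr G (k' \<cdot>\<^bsub>B\<^esub> k) \<cdot>\<^bsub>A\<^esub> u X = farr G k' \<cdot>\<^bsub>A\<^esub> (farr G k \<cdot>\<^bsub>A\<^esub> u X)"
    if "X \<in> Ob A" "k \<in> hom B (fob F X) Y" "k' \<in> hom B Y Z" for X Y Z k k'
    using that G.farr_cmp[OF that(2,3)]
      A.cmp_assoc[OF u_hom[OF that(1)] G.farr_hom[OF that(2)] G.farr_hom[OF that(3)]] by simp
  interpret F: cat_functor A B F
  proof
    fix X assume X: "X \<in> Ob A"
    show "farr F (ide A X) = ide B (fob F X)"
    proof (rule cancel[OF X F_hom[OF A.ide_hom[OF X]] G.dom.ide_hom[OF F_Ob[OF X]]])
      show "farr G (farr F (ide A X)) \<cdot>\<^bsub>A\<^esub> u X = farr G (ide B (fob F X)) \<cdot>\<^bsub>A\<^esub> u X"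
        using F_u[OF A.ide_hom[OF X]] A.cmp_ide_left[OF u_hom[OF X]] A.cmp_ide_right[OF u_hom[OF X]]
          G.farr_ide[OF F_Ob[OF X]] by simp
    qed
  next
    fix X Y Z f g assume f: "f \<in> hom A X Y" and g: "g \<in> hom A Y Z"
    note gf = A.cmp_hom[OF f g] and X = A.hom_Ob(1)[OF f] and Y = A.hom_Ob(2)[OF f]
      and Z = A.hom_Ob(2)[OF g]
    show "farr F (g \<cdot>\<^bsub>A\<^esub> f) = farr F g \<cdot>\<^bsub>B\<^esub> farr F f"
    proof (rule cancel[OF X F_hom[OF gf] G.dom.cmp_hom[OF F_hom[OF f] F_hom[OF g]]])
      have "farr G (farr F g \<cdot>\<^bsub>B\<^esub> farr F f) \<cdot>\<^bsub>A\<^esub> u X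
          = farr G (farr F g) \<cdot>\<^bsub>A\<^esub> (u Y \<cdot>\<^bsub>A\<^esub> f)"
        by (simp add: G_cmp[OF X F_hom[OF f] F_hom[OF g]] F_u[OF f])
      also have "\<dots> = (u Z \<cdot>\<^bsub>A\<^esub> g) \<cdot>\<^bsub>A\<^esub> f"
        by (simp add: A.cmp_assoc[OF f u_hom[OF Y] G.farr_hom[OF F_hom[OF g]], symmetric] F_u[OF g])
      also have "\<dots> = farr G (farr F (g \<cdot>\<^bsub>A\<^esub> f)) \<cdot>\<^bsub>A\<^esub> u X"
        by (simp add: F_u[OF gf] A.cmp_assoc[OF f g u_hom[OF Z]])
      finally show "farr G (farr F (g \<cdot>\<^bsub>A\<^esub> f)) \<cdot>\<^bsub>A\<^esub> u X
          = farr G (farr F g \<cdot>\<^bsub>B\<^esub> farr F f) \<cdot>\<^bsub>A\<^esub> u X" ..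
    qed
  qed (auto intro: F_Ob F_hom)
  define e where "e Y = (THE k. k \<in> hom B (fob F (fob G Y)) Y \<and>
    farr G k \<cdot>\<^bsub>A\<^esub> u (fob G Y) = ide A (fob G Y))" for Y
  have e: "e Y \<in> hom B (fob F (fob G Y)) Y \<and> farr G (e Y) \<cdot>\<^bsub>A\<^esub> u (fob G Y) = ide A (fob G Y)"
    if Y: "Y \<in> Ob B" for Y
    unfolding e_def by (rule theI', rule univ) (use Y in \<open>auto intro: G.fob_Ob A.ide_hom\<close>)
  note e_hom = conjunct1[OF e] and e_u = conjunct2[OF e]
  note functors = cat_functor_id[OF A] cat_functor_id[OF G.dom.category_axioms]
    cat_functor_cmp[OF F.cat_functor_axioms G] cat_functor_cmp[OF G F.cat_functor_axioms]
  have e_nat: "e Y' \<cdot>\<^bsub>B\<^esub> farr F (farr G f) = f \<cdot>\<^bsub>B\<^esub> e Y" if f: "f \<in> hom B Y Y'" for Y Y' f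
  proof -
    note Y = G.dom.hom_Ob(1)[OF f] and Y' = G.dom.hom_Ob(2)[OF f]
    note Gf = G.farr_hom[OF f]
    note FGf = F_hom[OF Gf] and GY = G.fob_Ob[OF Y] and GY' = G.fob_Ob[OF Y']
    show ?thesis
    proof (rule cancel[OF GY G.dom.cmp_hom[OF FGf e_hom[OF Y']] G.dom.cmp_hom[OF e_hom[OF Y] f]])
      show "farr G (e Y' \<cdot>\<^bsub>B\<^esub> farr F (farr G f)) \<cdot>\<^bsub>A\<^esub> u (fob G Y)
          = farr G (f \<cdot>\<^bsub>B\<^esub> e Y) \<cdot>\<^bsub>A\<^esub> u (fob G Y)"
        by (simp add: G_cmp[OF GY FGf e_hom[OF Y']] G_cmp[OF GY e_hom[OF Y] f] F_u[OF Gf] e_u[OF Y]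
            A.cmp_assoc[OF Gf u_hom[OF GY'] G.farr_hom[OF e_hom[OF Y']], symmetric] e_u[OF Y']
            A.cmp_ide_left[OF Gf] A.cmp_ide_right[OF Gf])
    qed
  qed
  have triangle: "e (fob F X) \<cdot>\<^bsub>B\<^esub> farr F (u X) = ide B (fob F X)" if X: "X \<in> Ob A" for X
  proof -
    note FX = F_Ob[OF X] and uX = u_hom[OF X]
    note GFX = G.fob_Ob[OF FX]
    show ?thesis
    proof (rule cancel[OF X G.dom.cmp_hom[OF F_hom[OF uX] e_hom[OF FX]] G.dom.ide_hom[OF FX]])
      show "farr G (e (fob F X) \<cdot>\<^bsub>B\<^esub> farr F (u X)) \<cdot>\<^bsub>A\<^esub> u X = farr G (ide B (fob F X)) \<cdot>\<^bsub>A\<^esub> u X"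
        by (simp add: G_cmp[OF X F_hom[OF uX] e_hom[OF FX]] F_u[OF uX] e_u[OF FX] G.farr_ide[OF FX]
            A.cmp_assoc[OF uX u_hom[OF GFX] G.farr_hom[OF e_hom[OF FX]], symmetric])
    qed
  qed
  have "adjunction A B F G u e"
    using A G.dom.category_axioms G F.cat_functor_axioms functors u_hom F_u e_hom e_nat e_u triangle
    unfolding adjunction_def adjunction_axioms_def nat_trans_def nat_trans_axioms_def
    by (auto simp: id_functor_def cmp_functor_def)
  then show ?thesis unfolding adjoint_functors_def by blast
qed

section \<open>Transposition along an adjunction\<close>

context adjunction
begin

text \<open>
  The two mutually inverse transposition maps.  They carry \<open>Y\<close> and \<open>X\<close> as parameters
  because these objects cannot be recovered from \<open>fob G Y\<close> and \<open>fob F X\<close>.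
\<close>

definition flat :: "'p \<Rightarrow> 'm \<Rightarrow> 'n"
  where "flat Y g = \<epsilon> Y \<cdot>\<^bsub>B\<^esub> farr F g"

definition sharp :: "'o \<Rightarrow> 'n \<Rightarrow> 'm"
  where "sharp X f = farr G f \<cdot>\<^bsub>A\<^esub> \<iota> X"

lemma unit_hom: "X \<in> Ob A \<Longrightarrow> \<iota> X \<in> hom A X (fob G (fob F X))"
  using unit.component_hom by (simp add: id_functor_def cmp_functor_def)

lemma counit_hom: "Y \<in> Ob B \<Longrightarrow> \<epsilon> Y \<in> hom B (fob F (fob G Y)) Y"
  using counit.component_hom by (simp add: id_functor_def cmp_functor_def)

lemma unit_nat: "f \<in> hom A X X' \<Longrightarrow> \<iota> X' \<cdot>\<^bsub>A\<^esub> f = farr G (farr F f) \<cdot>\<^bsub>A\<^esub> \<iota> X"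
  using unit.naturality by (simp add: id_functor_def cmp_functor_def)

lemma counit_nat: "f \<in> hom B Y Y' \<Longrightarrow> \<epsilon> Y' \<cdot>\<^bsub>B\<^esub> farr F (farr G f) = f \<cdot>\<^bsub>B\<^esub> \<epsilon> Y"
  using counit.naturality by (simp add: id_functor_def cmp_functor_def)

lemma flat_hom: "\<lbrakk>g \<in> hom A X (fob G Y); Y \<in> Ob B\<rbrakk> \<Longrightarrow> flat Y g \<in> hom B (fob F X) Y"
  unfolding flat_def by (rule counit.src.dom.cmp_hom[OF left.farr_hom counit_hom])

lemma sharp_hom: "\<lbrakk>f \<in> hom B (fob F X) Y; X \<in> Ob A\<rbrakk> \<Longrightarrow> sharp X f \<in> hom A X (fob G Y)"
  unfolding sharp_def by (rule unit.src.dom.cmp_hom[OF unit_hom right.farr_hom])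

lemma flat_sharp:
  assumes f: "f \<in> hom B (fob F X) Y" and X: "X \<in> Ob A"
  shows "flat Y (sharp X f) = f"
proof -
  note Gf = right.farr_hom[OF f] and FX = left.fob_Ob[OF X] and Y = counit.src.dom.hom_Ob(2)[OF f]
  have "flat Y (sharp X f) = (\<epsilon> Y \<cdot>\<^bsub>B\<^esub> farr F (farr G f)) \<cdot>\<^bsub>B\<^esub> farr F (\<iota> X)"
    unfolding flat_def sharp_def
    by (simp add: left.farr_cmp[OF unit_hom[OF X] Gf]
        counit.src.dom.cmp_assoc[OF left.farr_hom[OF unit_hom[OF X]] left.farr_hom[OF Gf] counit_hom[OF Y]])
  then show ?thesis
    by (simp add: counit_nat[OF f] triangle_left[OF X] counit.src.dom.cmp_ide_right[OF f]
        counit.src.dom.cmp_assoc[OF left.farr_hom[OF unit_hom[OF X]] counit_hom[OF FX] f])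
qed

lemma sharp_flat:
  assumes g: "g \<in> hom A X (fob G Y)" and Y: "Y \<in> Ob B"
  shows "sharp X (flat Y g) = g"
proof -
  note Fg = left.farr_hom[OF g] and GY = right.fob_Ob[OF Y] and X = unit.src.dom.hom_Ob(1)[OF g]
  have "sharp X (flat Y g) = farr G (\<epsilon> Y) \<cdot>\<^bsub>A\<^esub> (farr G (farr F g) \<cdot>\<^bsub>A\<^esub> \<iota> X)"
    unfolding flat_def sharp_def
    by (simp add: right.farr_cmp[OF Fg counit_hom[OF Y]]
        unit.src.dom.cmp_assoc[OF unit_hom[OF X] right.farr_hom[OF Fg] right.farr_hom[OF counit_hom[OF Y]]])
  then show ?thesis
    by (simp add: unit_nat[OF g, symmetric] triangle_right[OF Y] unit.src.dom.cmp_ide_left[OF g]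
        unit.src.dom.cmp_assoc[OF g unit_hom[OF GY] right.farr_hom[OF counit_hom[OF Y]], symmetric])
qed

lemma flat_eq_iff:
  assumes "g \<in> hom A X (fob G Y)" "g' \<in> hom A X (fob G Y)" "Y \<in> Ob B"
  shows "flat Y g = flat Y g' \<longleftrightarrow> g = g'"
  using sharp_flat[OF assms(1,3)] sharp_flat[OF assms(2,3)] by metis

lemma flat_cmp:
  assumes h: "h \<in> hom A X' X" and g: "g \<in> hom A X (fob G Y)" and Y: "Y \<in> Ob B"
  shows "flat Y (g \<cdot>\<^bsub>A\<^esub> h) = flat Y g \<cdot>\<^bsub>B\<^esub> farr F h"
  unfolding flat_def
  by (simp add: left.farr_cmp[OF h g]
      counit.src.dom.cmp_assoc[OF left.farr_hom[OF h] left.farr_hom[OF g] counit_hom[OF Y]])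

lemma flat_farr_cmp:
  assumes g: "g \<in> hom A X (fob G Y)" and k: "k \<in> hom B Y Y'"
  shows "flat Y' (farr G k \<cdot>\<^bsub>A\<^esub> g) = k \<cdot>\<^bsub>B\<^esub> flat Y g"
proof -
  note Y = counit.src.dom.hom_Ob[OF k]
  show ?thesis
    unfolding flat_cmp[OF g right.farr_hom[OF k] Y(2)]
    unfolding flat_def
    by (simp add: counit_nat[OF k] counit.src.dom.cmp_assoc[OF left.farr_hom[OF g] counit_hom[OF Y(1)] k])
qed

lemma flat_ide: "Y \<in> Ob B \<Longrightarrow> flat Y (ide A (fob G Y)) = \<epsilon> Y"
  unfolding flat_def
  by (simp add: left.farr_ide right.fob_Ob counit.src.dom.cmp_ide_right[OF counit_hom])

lemma flat_farr:
  assumes k: "k \<in> hom B Y Y'"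
  shows "flat Y' (farr G k) = k \<cdot>\<^bsub>B\<^esub> \<epsilon> Y"
  using counit_nat[OF k] by (simp add: flat_def)

end

section \<open>The Eilenberg--Moore category\<close>

text \<open>
  A morphism with given source and target algebras is determined by its middle component, which
  reduces statements about the Eilenberg--Moore category to statements about \<open>E\<close>.
\<close>

lemma (in monad) hom_Alg_iff:
  "p \<in> hom (Alg E T \<eta> \<mu>) x y \<longleftrightarrow>
    (\<exists>f. p = (x, f, y) \<and> x \<in> algebras E T \<eta> \<mu> \<and> y \<in> algebras E T \<eta> \<mu> \<and>
      f \<in> hom E (fst x) (fst y) \<and> f \<cdot>\<^bsub>E\<^esub> snd x = snd y \<cdot>\<^bsub>E\<^esub> farr T f)"
  unfolding hom_def[of "Alg E T \<eta> \<mu>"] by (cases x; cases y) (auto simp: Alg_def)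

lemma (in monad) category_Alg: "category (Alg E T \<eta> \<mu>)"
proof
  let ?A = "Alg E T \<eta> \<mu>"
  fix p assume "p \<in> Mor ?A"
  then show "Dom ?A p \<in> Ob ?A" "Cod ?A p \<in> Ob ?A" by (auto simp: Alg_def)
next
  let ?A = "Alg E T \<eta> \<mu>"
  fix x assume "x \<in> Ob ?A"
  then show "ide ?A x \<in> hom ?A x x"
    unfolding hom_Alg_iff
    by (auto simp: Alg_def algebras_def endo.dom.ide_hom endo.farr_ide
        endo.dom.cmp_ide_left endo.dom.cmp_ide_right)
next
  let ?A = "Alg E T \<eta> \<mu>"
  fix p q x y z assume "p \<in> hom ?A x y" "q \<in> hom ?A y z"
  then obtain f g where pq: "p = (x, f, y)" "q = (y, g, z)"
    and alg: "x \<in> algebras E T \<eta> \<mu>" "y \<in> algebras E T \<eta> \<mu>" "z \<in> algebras E T \<eta> \<mu>"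
    and f: "f \<in> hom E (fst x) (fst y)" and g: "g \<in> hom E (fst y) (fst z)"
    and f_alg: "f \<cdot>\<^bsub>E\<^esub> snd x = snd y \<cdot>\<^bsub>E\<^esub> farr T f" and g_alg: "g \<cdot>\<^bsub>E\<^esub> snd y = snd z \<cdot>\<^bsub>E\<^esub> farr T g"
    unfolding hom_Alg_iff by blast
  have a: "snd x \<in> hom E (fob T (fst x)) (fst x)" "snd y \<in> hom E (fob T (fst y)) (fst y)"
    "snd z \<in> hom E (fob T (fst z)) (fst z)"
    using alg by (auto simp: algebras_def)
  have "(g \<cdot>\<^bsub>E\<^esub> f) \<cdot>\<^bsub>E\<^esub> snd x = snd z \<cdot>\<^bsub>E\<^esub> farr T (g \<cdot>\<^bsub>E\<^esub> f)"
    by (simp add: endo.farr_cmp[OF f g] endo.dom.cmp_assoc[OF a(1) f g] f_alg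
        endo.dom.cmp_assoc[OF endo.farr_hom[OF f] a(2) g, symmetric] g_alg
        endo.dom.cmp_assoc[OF endo.farr_hom[OF f] endo.farr_hom[OF g] a(3)])
  then show "q \<cdot>\<^bsub>?A\<^esub> p \<in> hom ?A x z"
    unfolding hom_Alg_iff using alg pq endo.dom.cmp_hom[OF f g] by (simp add: Alg_def)
next
  let ?A = "Alg E T \<eta> \<mu>"
  fix p x y assume "p \<in> hom ?A x y"
  then show "ide ?A y \<cdot>\<^bsub>?A\<^esub> p = p" "p \<cdot>\<^bsub>?A\<^esub> ide ?A x = p"
    unfolding hom_Alg_iff
    by (auto simp: Alg_def endo.dom.cmp_ide_left endo.dom.cmp_ide_right split: prod.splits)
next
  let ?A = "Alg E T \<eta> \<mu>"
  fix p q r w x y z assume "p \<in> hom ?A w x" "q \<in> hom ?A x y" "r \<in> hom ?A y z"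
  then show "(r \<cdot>\<^bsub>?A\<^esub> q) \<cdot>\<^bsub>?A\<^esub> p = r \<cdot>\<^bsub>?A\<^esub> (q \<cdot>\<^bsub>?A\<^esub> p)"
    unfolding hom_Alg_iff by (auto simp: Alg_def endo.dom.cmp_assoc)
qed

section \<open>Comparison and realization\<close>

locale module_adjunction =
  right_module E T \<eta> \<mu> C L \<alpha> + adj: adjunction E C L R \<iota> \<epsilon>
  for E :: "('o, 'm) cat_data" and T :: "('o, 'm, 'o, 'm) functor_data"
    and \<eta> :: "'o \<Rightarrow> 'm" and \<mu> :: "'o \<Rightarrow> 'm" and C :: "('p, 'n) cat_data"
    and L :: "('o, 'm, 'p, 'n) functor_data" and \<alpha> :: "'o \<Rightarrow> 'n"
    and R :: "('p, 'n, 'o, 'm) functor_data" and \<iota> :: "'o \<Rightarrow> 'm" and \<epsilon> :: "'p \<Rightarrow> 'n"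
begin

abbreviation \<rho> :: "'p \<Rightarrow> 'm"
  where "\<rho> \<equiv> mate E T R \<iota> \<epsilon> \<alpha>"

lemma action_hom: "X \<in> Ob E \<Longrightarrow> \<alpha> X \<in> hom C (fob L (fob T X)) (fob L X)"
  using action.component_hom by (simp add: cmp_functor_def)

lemma action_nat: "f \<in> hom E X Y \<Longrightarrow> \<alpha> Y \<cdot>\<^bsub>C\<^esub> farr L (farr T f) = farr L f \<cdot>\<^bsub>C\<^esub> \<alpha> X"
  using action.naturality by (simp add: cmp_functor_def)

lemma monad_unit_hom: "X \<in> Ob E \<Longrightarrow> \<eta> X \<in> hom E X (fob T X)"
  using unit.component_hom by (simp add: id_functor_def)

lemma monad_mult_hom: "X \<in> Ob E \<Longrightarrow> \<mu> X \<in> hom E (fob T (fob T X)) (fob T X)"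
  using mult.component_hom by (simp add: cmp_functor_def)

lemma counit_action_hom:
  "c \<in> Ob C \<Longrightarrow> \<epsilon> c \<cdot>\<^bsub>C\<^esub> \<alpha> (fob R c) \<in> hom C (fob L (fob T (fob R c))) c"
  by (rule mod.cod.cmp_hom[OF action_hom[OF adj.right.fob_Ob] adj.counit_hom])

lemma mate_eq_sharp:
  assumes c: "c \<in> Ob C"
  shows "\<rho> c = adj.sharp (fob T (fob R c)) (\<epsilon> c \<cdot>\<^bsub>C\<^esub> \<alpha> (fob R c))"
  unfolding mate_def adj.sharp_def
  by (simp add: adj.right.farr_cmp[OF action_hom[OF adj.right.fob_Ob[OF c]] adj.counit_hom[OF c]])

lemma mate_hom: "c \<in> Ob C \<Longrightarrow> \<rho> c \<in> hom E (fob T (fob R c)) (fob R c)"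
  unfolding mate_eq_sharp
  by (rule adj.sharp_hom[OF counit_action_hom endo.fob_Ob[OF adj.right.fob_Ob]])

lemma flat_mate: "c \<in> Ob C \<Longrightarrow> adj.flat c (\<rho> c) = \<epsilon> c \<cdot>\<^bsub>C\<^esub> \<alpha> (fob R c)"
  unfolding mate_eq_sharp
  by (rule adj.flat_sharp[OF counit_action_hom endo.fob_Ob[OF adj.right.fob_Ob]])

text \<open>
  Both equations are transposes of each other: \<open>g \<cdot> a\<close> transposes to the composite with \<open>La\<close>, and
  since \<open>\<rho>\<close> transposes to \<open>\<epsilon> \<cdot> \<alpha>\<close>, naturality of \<open>\<alpha>\<close> moves \<open>\<rho> \<cdot> T g\<close> to the composite with \<open>\<alpha>\<close>.
  For \<open>g = \<rho> c\<close> and \<open>a = \<mu>\<close> the left-hand equation is the associativity of \<open>\<rho> c\<close>, for \<open>g = R k\<close> and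
  \<open>a = \<rho> c\<close> it is the naturality of \<open>\<rho>\<close>, and for an algebra \<open>(X, a)\<close> it describes the algebra
  morphisms to \<open>K c\<close>.
\<close>

lemma mate_compatible_iff_flat_coequalizes:
  assumes a: "a \<in> hom E (fob T X) X" and g: "g \<in> hom E X (fob R c)" and c: "c \<in> Ob C"
  shows "g \<cdot>\<^bsub>E\<^esub> a = \<rho> c \<cdot>\<^bsub>E\<^esub> farr T g
    \<longleftrightarrow> adj.flat c g \<cdot>\<^bsub>C\<^esub> farr L a = adj.flat c g \<cdot>\<^bsub>C\<^esub> \<alpha> X"
proof -
  note X = endo.dom.hom_Ob(1)[OF g] and Tg = endo.farr_hom[OF g] and Rc = adj.right.fob_Ob[OF c]
  have "adj.flat c (\<rho> c \<cdot>\<^bsub>E\<^esub> farr T g) = \<epsilon> c \<cdot>\<^bsub>C\<^esub> (\<alpha> (fob R c) \<cdot>\<^bsub>C\<^esub> farr L (farr T g))"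
    by (simp add: adj.flat_cmp[OF Tg mate_hom[OF c] c] flat_mate[OF c]
        mod.cod.cmp_assoc[OF mod.farr_hom[OF Tg] action_hom[OF Rc] adj.counit_hom[OF c]])
  also have "\<dots> = adj.flat c g \<cdot>\<^bsub>C\<^esub> \<alpha> X"
    unfolding adj.flat_def action_nat[OF g]
    by (rule mod.cod.cmp_assoc[OF action_hom[OF X] mod.farr_hom[OF g] adj.counit_hom[OF c],
          symmetric])
  finally have "adj.flat c (\<rho> c \<cdot>\<^bsub>E\<^esub> farr T g) = adj.flat c g \<cdot>\<^bsub>C\<^esub> \<alpha> X" .
  then show ?thesis
    using adj.flat_eq_iff[OF endo.dom.cmp_hom[OF a g] endo.dom.cmp_hom[OF Tg mate_hom[OF c]] c]
      adj.flat_cmp[OF a g c] by simp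
qed

text \<open>
  Both algebra laws are checked on transposes, where they become the two module axioms composed
  with \<open>\<epsilon> c\<close>.  Associativity says that \<open>\<rho> c\<close> is compatible with the free structure \<open>\<mu>\<close> on its source.
\<close>

lemma mate_algebra:
  assumes c: "c \<in> Ob C"
  shows "(fob R c, \<rho> c) \<in> algebras E T \<eta> \<mu>"
proof -
  let ?X = "fob R c"
  note X = adj.right.fob_Ob[OF c]
  note TX = endo.fob_Ob[OF X] and \<epsilon> = adj.counit_hom[OF c] and \<eta> = monad_unit_hom[OF X]
    and \<mu> = monad_mult_hom[OF X] and \<rho> = mate_hom[OF c]
  have "adj.flat c (\<rho> c \<cdot>\<^bsub>E\<^esub> \<eta> ?X) = adj.flat c (ide E ?X)"
    by (simp add: adj.flat_cmp[OF \<eta> \<rho> c] flat_mate[OF c] action_unit[OF X] adj.flat_ide[OF c]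
        mod.cod.cmp_assoc[OF mod.farr_hom[OF \<eta>] action_hom[OF X] \<epsilon>] mod.cod.cmp_ide_right[OF \<epsilon>])
  then have "\<rho> c \<cdot>\<^bsub>E\<^esub> \<eta> ?X = ide E ?X"
    by (simp add: adj.flat_eq_iff[OF endo.dom.cmp_hom[OF \<eta> \<rho>] endo.dom.ide_hom[OF X] c])
  moreover have "\<rho> c \<cdot>\<^bsub>E\<^esub> farr T (\<rho> c) = \<rho> c \<cdot>\<^bsub>E\<^esub> \<mu> ?X"
    using mate_compatible_iff_flat_coequalizes[OF \<mu> \<rho> c]
    by (simp add: flat_mate[OF c] mod.cod.cmp_assoc[OF mod.farr_hom[OF \<mu>] action_hom[OF X] \<epsilon>]
        mod.cod.cmp_assoc[OF action_hom[OF TX] action_hom[OF X] \<epsilon>] action_mult[OF X])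
  ultimately show ?thesis using X \<rho> by (simp add: algebras_def)
qed

text \<open>
  The point is that \<open>R k\<close> is an algebra morphism: its transpose is \<open>k \<cdot> \<epsilon> c\<close>, and \<open>\<epsilon> c\<close> already
  coequalizes \<open>L(\<rho> c)\<close> and \<open>\<alpha>\<close>, since both composites are the transpose of \<open>\<rho> c\<close>.
\<close>

lemma cat_functor_comparison: "cat_functor C (Alg E T \<eta> \<mu>) (comparison_functor E T C R \<iota> \<epsilon> \<alpha>)"
proof -
  interpret Alg: category "Alg E T \<eta> \<mu>" by (rule category_Alg)
  show ?thesis
  proof
    fix c assume "c \<in> Ob C"
    then show "fob (comparison_functor E T C R \<iota> \<epsilon> \<alpha>) c \<in> Ob (Alg E T \<eta> \<mu>)"
      using mate_algebra by (simp add: comparison_functor_def Alg_def)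
  next
    fix k c d assume k: "k \<in> hom C c d"
    note c = mod.cod.hom_Ob(1)[OF k] and d = mod.cod.hom_Ob(2)[OF k]
    note Rk = adj.right.farr_hom[OF k] and \<epsilon> = adj.counit_hom[OF c]
      and X = adj.right.fob_Ob[OF c]
    have "k \<cdot>\<^bsub>C\<^esub> \<epsilon> c \<cdot>\<^bsub>C\<^esub> farr L (\<rho> c) = k \<cdot>\<^bsub>C\<^esub> \<epsilon> c \<cdot>\<^bsub>C\<^esub> \<alpha> (fob R c)"
      using flat_mate[OF c] unfolding adj.flat_def
      by (simp add: mod.cod.cmp_assoc[OF mod.farr_hom[OF mate_hom[OF c]] \<epsilon> k]
          mod.cod.cmp_assoc[OF action_hom[OF X] \<epsilon> k])
    then have "farr R k \<cdot>\<^bsub>E\<^esub> \<rho> c = \<rho> d \<cdot>\<^bsub>E\<^esub> farr T (farr R k)"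
      unfolding mate_compatible_iff_flat_coequalizes[OF mate_hom[OF c] Rk d] adj.flat_farr[OF k] .
    then show "farr (comparison_functor E T C R \<iota> \<epsilon> \<alpha>) k \<in> hom (Alg E T \<eta> \<mu>)
        (fob (comparison_functor E T C R \<iota> \<epsilon> \<alpha>) c) (fob (comparison_functor E T C R \<iota> \<epsilon> \<alpha>) d)"
      using k Rk mate_algebra[OF c] mate_algebra[OF d] unfolding hom_Alg_iff
      by (simp add: comparison_functor_def hom_def)
  next
    fix c assume c: "c \<in> Ob C"
    then show "farr (comparison_functor E T C R \<iota> \<epsilon> \<alpha>) (ide C c)
        = ide (Alg E T \<eta> \<mu>) (fob (comparison_functor E T C R \<iota> \<epsilon> \<alpha>) c)"
      using mod.cod.ide_hom[OF c] adj.right.farr_ide[OF c]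
      by (simp add: comparison_functor_def Alg_def hom_def)
  next
    fix k l c d e assume k: "k \<in> hom C c d" and l: "l \<in> hom C d e"
    then show "farr (comparison_functor E T C R \<iota> \<epsilon> \<alpha>) (l \<cdot>\<^bsub>C\<^esub> k)
        = farr (comparison_functor E T C R \<iota> \<epsilon> \<alpha>) l
          \<cdot>\<^bsub>Alg E T \<eta> \<mu>\<^esub> farr (comparison_functor E T C R \<iota> \<epsilon> \<alpha>) k"
      using mod.cod.cmp_hom[OF k l] adj.right.farr_cmp[OF k l]
      by (simp add: comparison_functor_def Alg_def hom_def)
  qed
qed

lemma coequalizer_hom:
  assumes "a \<in> hom E (fob T X) X" and "is_coequalizer C (farr L a) (\<alpha> X) q"
  shows "q \<in> hom C (fob L X) (Cod C q)" and "q \<cdot>\<^bsub>C\<^esub> farr L a = q \<cdot>\<^bsub>C\<^esub> \<alpha> X"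
  using mod.farr_hom[OF assms(1)] assms(2) by (simp_all add: is_coequalizer_def hom_def)

lemma coequalizer_factors:
  assumes "a \<in> hom E (fob T X) X" and "is_coequalizer C (farr L a) (\<alpha> X) q"
    and "h \<in> hom C (fob L X) c" and "h \<cdot>\<^bsub>C\<^esub> farr L a = h \<cdot>\<^bsub>C\<^esub> \<alpha> X"
  shows "\<exists>!k. k \<in> hom C (Cod C q) c \<and> k \<cdot>\<^bsub>C\<^esub> q = h"
proof -
  have "h \<in> Mor C" "Dom C h = Cod C (farr L a)" and c: "Cod C h = c"
    using mod.farr_hom[OF assms(1)] assms(3) by (simp_all add: hom_def)
  then show ?thesis
    using assms(2,4) unfolding is_coequalizer_def c[symmetric] by blast
qed

text \<open>
  The transposes \<open>u\<close> of the coequalizer maps are universal arrows to the comparison functor: for an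
  algebra morphism \<open>g\<close> into \<open>K c\<close>, the equation \<open>R k \<cdot> u = g\<close> transposes to \<open>k \<cdot> q = flat c g\<close>, which
  has exactly one solution \<open>k\<close> because the right-hand side coequalizes the defining pair.
\<close>

lemma realization_adjoint_comparison:
  assumes choice: "realization_choice E T \<eta> \<mu> C L \<alpha> q"
  shows "adjoint_functors (Alg E T \<eta> \<mu>) C
    (realization_functor C L q) (comparison_functor E T C R \<iota> \<epsilon> \<alpha>)"
proof -
  let ?A = "Alg E T \<eta> \<mu>" and ?F = "realization_functor C L q"
    and ?K = "comparison_functor E T C R \<iota> \<epsilon> \<alpha>"
  define u where "u x = (x, adj.sharp (fst x) (q x), fob ?K (Cod C (q x)))" for x
  have alg: "fst x \<in> Ob E" "snd x \<in> hom E (fob T (fst x)) (fst x)"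
    if "x \<in> algebras E T \<eta> \<mu>" for x
    using that by (auto simp: algebras_def)
  have coeq: "is_coequalizer C (farr L (snd x)) (\<alpha> (fst x)) (q x)"
    if "x \<in> algebras E T \<eta> \<mu>" for x
    using choice that unfolding realization_choice_def by auto
  note q = coequalizer_hom[OF alg(2) coeq]
  have q_Ob: "Cod C (q x) \<in> Ob C" if "x \<in> algebras E T \<eta> \<mu>" for x
    using mod.cod.hom_Ob(2)[OF q(1)[OF that that]] .
  have u_E: "adj.sharp (fst x) (q x) \<in> hom E (fst x) (fob R (Cod C (q x)))"
    if "x \<in> algebras E T \<eta> \<mu>" for x
    using adj.sharp_hom[OF q(1)[OF that that] alg(1)[OF that]] .
  have flat_u: "adj.flat (Cod C (q x)) (adj.sharp (fst x) (q x)) = q x"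
    if "x \<in> algebras E T \<eta> \<mu>" for x
    using adj.flat_sharp[OF q(1)[OF that that] alg(1)[OF that]] .
  have u_hom: "u x \<in> hom ?A x (fob ?K (Cod C (q x)))" if x: "x \<in> algebras E T \<eta> \<mu>" for x
  proof -
    have "adj.sharp (fst x) (q x) \<cdot>\<^bsub>E\<^esub> snd x
        = \<rho> (Cod C (q x)) \<cdot>\<^bsub>E\<^esub> farr T (adj.sharp (fst x) (q x))"
      unfolding mate_compatible_iff_flat_coequalizes[OF alg(2)[OF x] u_E[OF x] q_Ob[OF x]]
        flat_u[OF x] by (rule q(2)[OF x x])
    then show ?thesis
      unfolding hom_Alg_iff u_def using x u_E[OF x] mate_algebra[OF q_Ob[OF x]]
      by (simp add: comparison_functor_def)
  qed
  have K_u: "farr ?K k \<cdot>\<^bsub>?A\<^esub> u x = (x, farr R k \<cdot>\<^bsub>E\<^esub> adj.sharp (fst x) (q x), fob ?K c)"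
    if "k \<in> hom C (Cod C (q x)) c" for k x c
    using that by (simp add: u_def comparison_functor_def Alg_def hom_def)
  have R_u: "farr R k \<cdot>\<^bsub>E\<^esub> adj.sharp (fst x) (q x) = g \<longleftrightarrow> k \<cdot>\<^bsub>C\<^esub> q x = adj.flat c g"
    if x: "x \<in> algebras E T \<eta> \<mu>" and k: "k \<in> hom C (Cod C (q x)) c"
      and g: "g \<in> hom E (fst x) (fob R c)" for x k c g
    using adj.flat_eq_iff[OF endo.dom.cmp_hom[OF u_E[OF x] adj.right.farr_hom[OF k]] g
        mod.cod.hom_Ob(2)[OF k]]
    by (simp add: adj.flat_farr_cmp[OF u_E[OF x] k] flat_u[OF x])
  have univ: "\<exists>!k. k \<in> hom C (Cod C (q x)) c \<and> farr ?K k \<cdot>\<^bsub>?A\<^esub> u x = p"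
    if x: "x \<in> algebras E T \<eta> \<mu>" and c: "c \<in> Ob C" and p: "p \<in> hom ?A x (fob ?K c)" for x c p
  proof -
    obtain g where pg: "p = (x, g, fob ?K c)" and g: "g \<in> hom E (fst x) (fob R c)"
      and g_alg: "g \<cdot>\<^bsub>E\<^esub> snd x = \<rho> c \<cdot>\<^bsub>E\<^esub> farr T g"
      using p unfolding hom_Alg_iff by (auto simp: comparison_functor_def)
    have "k \<in> hom C (Cod C (q x)) c \<and> farr ?K k \<cdot>\<^bsub>?A\<^esub> u x = p
        \<longleftrightarrow> k \<in> hom C (Cod C (q x)) c \<and> k \<cdot>\<^bsub>C\<^esub> q x = adj.flat c g" for k
      using R_u[OF x _ g] K_u[of _ x c] by (auto simp: pg)
    then show ?thesis
      using coequalizer_factors[OF alg(2)[OF x] coeq[OF x] adj.flat_hom[OF g c]]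
        mate_compatible_iff_flat_coequalizes[OF alg(2)[OF x] g c] g_alg by simp
  qed
  have F_arr: "farr ?F p \<in> hom C (Cod C (q x)) (Cod C (q y)) \<and> farr ?K (farr ?F p) \<cdot>\<^bsub>?A\<^esub> u x = u y \<cdot>\<^bsub>?A\<^esub> p"
    if p: "p \<in> hom ?A x y" for p x y
  proof -
    interpret Alg: category ?A by (rule category_Alg)
    obtain f where pf: "p = (x, f, y)" and x: "x \<in> algebras E T \<eta> \<mu>" and y: "y \<in> algebras E T \<eta> \<mu>"
      and f: "f \<in> hom E (fst x) (fst y)"
      using p unfolding hom_Alg_iff by blast
    note g = endo.dom.cmp_hom[OF f u_E[OF y]]
    have up: "u y \<cdot>\<^bsub>?A\<^esub> p = (x, adj.sharp (fst y) (q y) \<cdot>\<^bsub>E\<^esub> f, fob ?K (Cod C (q y)))"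
      by (simp add: pf u_def Alg_def)
    \<comment> \<open>The equation that defines the realization of a morphism is the transpose of the naturality
      square of \<open>u\<close>, so its unique solvability follows from universality.\<close>
    have iff: "k \<in> hom C (Cod C (q x)) (Cod C (q y)) \<and> k \<cdot>\<^bsub>C\<^esub> q x = q y \<cdot>\<^bsub>C\<^esub> farr L f
        \<longleftrightarrow> k \<in> hom C (Cod C (q x)) (Cod C (q y)) \<and> farr ?K k \<cdot>\<^bsub>?A\<^esub> u x = u y \<cdot>\<^bsub>?A\<^esub> p" for k
      using R_u[OF x _ g] K_u[of _ x "Cod C (q y)"] adj.flat_cmp[OF f u_E[OF y] q_Ob[OF y]] flat_u[OF y]
      by (auto simp: up)
    have "farr ?F p = (THE k. k \<in> hom C (Cod C (q x)) (Cod C (q y)) \<and>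
        farr ?K k \<cdot>\<^bsub>?A\<^esub> u x = u y \<cdot>\<^bsub>?A\<^esub> p)"
      by (simp add: realization_functor_def pf iff[unfolded pf])
    then show ?thesis
      using theI'[OF univ[OF x q_Ob[OF y] Alg.cmp_hom[OF p u_hom[OF y]]]] by simp
  qed
  show ?thesis
    by (rule adjoint_functors_if_universal_arrows[where u = u, OF category_Alg cat_functor_comparison])
      (use u_hom univ F_arr q_Ob in \<open>simp_all add: realization_functor_def Alg_def\<close>)
qed

end

theorem theorem7p15:
  fixes E :: "('o, 'm) cat_data" and T :: "('o, 'm, 'o, 'm) functor_data"
    and \<eta> \<mu> :: "'o \<Rightarrow> 'm" and C :: "('p, 'n) cat_data"
    and L :: "('o, 'm, 'p, 'n) functor_data" and \<alpha> :: "'o \<Rightarrow> 'n"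
    and R :: "('p, 'n, 'o, 'm) functor_data" and \<iota> :: "'o \<Rightarrow> 'm" and \<epsilon> :: "'p \<Rightarrow> 'n"
  assumes "monad E T \<eta> \<mu>"
    and "category C"
    and "left_adjoint_right_module E T \<eta> \<mu> C L \<alpha>"
    and "adjunction E C L R \<iota> \<epsilon>"
    and "\<And>X a. (X, a) \<in> algebras E T \<eta> \<mu> \<Longrightarrow> \<exists>q. is_coequalizer C (farr L a) (\<alpha> X) q"
  shows "(\<exists>q. realization_choice E T \<eta> \<mu> C L \<alpha> q) \<and>
    (\<forall>q. realization_choice E T \<eta> \<mu> C L \<alpha> q \<longrightarrow>
      adjoint_functors (Alg E T \<eta> \<mu>) C
        (realization_functor C L q) (comparison_functor E T C R \<iota> \<epsilon> \<alpha>))"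
proof (intro conjI allI impI)
  have "\<forall>x\<in>algebras E T \<eta> \<mu>. \<exists>q. is_coequalizer C (farr L (snd x)) (\<alpha> (fst x)) q"
    using assms(5) by auto
  then obtain q where "\<forall>x\<in>algebras E T \<eta> \<mu>. is_coequalizer C (farr L (snd x)) (\<alpha> (fst x)) (q x)"
    by metis
  then show "\<exists>q. realization_choice E T \<eta> \<mu> C L \<alpha> q"
    unfolding realization_choice_def by (intro exI[of _ q]) auto
next
  fix q assume choice: "realization_choice E T \<eta> \<mu> C L \<alpha> q"
  interpret module_adjunction E T \<eta> \<mu> C L \<alpha> R \<iota> \<epsilon>
    using assms(3,4) by (simp add: module_adjunction_def left_adjoint_right_module_def)
  show "adjoint_functors (Alg E T \<eta> \<mu>) C
      (realization_functor C L q) (comparison_functor E T C R \<iota> \<epsilon> \<alpha>)"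
    using choice by (rule realization_adjoint_comparison)
qed

end
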